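(* Let $k\ge 1$ and use the convention $D_k(j)=0$ for negative integers $j$. Then for every integer $n\ge 0$, $$D_k(2n+1)=\sum_{i\ge 0}\binom{k}{4i+2}D_k(n-i)=\binom{k}{2}D_k(n)+\binom{k}{6}D_k(n-1)+\binom{k}{10}D_k(n-2)+\cdots,$$ $$D_k(2n+2)=\sum_{i\ge 0}\binom{k}{4i}D_k(n+1-i)=\binom{k}{0}D_k(n+1)+\binom{k}{4}D_k(n)+\binom{k}{8}D_k(n-1)+\cdots.$$
   Context: A P-position of the game of Nim with $k$ piles is a $k$-tuple $(p_1,\dots,p_k)$ of non-negative integers whose nim-sum $p_1\oplus\cdots\oplus p_k$ is $0$, where $\oplus$ denotes bitwise XOR. $D_k(n)$ denotes the number of P-positions with $k$ piles whose total number of counters equals exactly $2n$. Binomial coefficients $\binom{k}{m}$ with $m>k$ are $0$. *)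

theory Defs
  imports Complex_Main
begin

unbundle bit_operations_syntax

definition nim_sum :: "nat list \<Rightarrow> nat" where
  "nim_sum ps = foldr (XOR) ps 0"

text \<open>A position with k piles is an ordered k-tuple, represented as a list of length k.\<close>

definition P_positions :: "nat \<Rightarrow> nat list set" where
  "P_positions k = {ps. length ps = k \<and> nim_sum ps = 0}"

text \<open>The second argument is an integer: for a negative one no position qualifies, so the
  count is 0 (lemma \<open>D_neg\<close>). The counted set is always finite (lemma
  \<open>finite_P_positions_total\<close>), so the cardinality is the true number of positions.\<close>

definition D :: "nat \<Rightarrow> int \<Rightarrow> nat" where
  "D k n = card {ps \<in> P_positions k. int (sum_list ps) = 2 * n}"

lemma D_neg: "n < 0 \<Longrightarrow> D k n = 0"
  by (auto simp: D_def intro!: card_eq_0_iff[THEN iffD2])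

lemma finite_P_positions_total: "finite {ps \<in> P_positions k. int (sum_list ps) = 2 * n}"
proof (rule finite_subset)
  show "{ps \<in> P_positions k. int (sum_list ps) = 2 * n}
      \<subseteq> {ps. set ps \<subseteq> {..nat (2 * n)} \<and> length ps = k}"
    by (auto simp: P_positions_def dest: member_le_sum_list)
  show "finite {ps. set ps \<subseteq> {..nat (2 * n)} \<and> length ps = k}"
    by (rule finite_lists_length_eq) simp
qed

end

theory Submission
  imports Defs
begin

text \<open>Split every pile as \<open>2 * q + b\<close> with its lowest bit \<open>b\<close>. The nim-sum vanishes iff the
  halves \<open>q\<close> form a P-position and the number \<open>c\<close> of odd piles is even. As the nim-sum has the
  parity of the sum, the halves total some \<open>2 * m\<close>, so a total of \<open>2 * N\<close> forces
  \<open>c = 2 * N - 4 * m\<close>: the residue of \<open>c\<close> modulo 4 is fixed by the parity of \<open>N\<close>, and the odd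
  piles may be chosen in \<open>k choose c\<close> ways.\<close>

text \<open>Pascal's rule, by splitting on the first entry. With \<open>True\<close> marking an odd
  pile, this counts the choices of the odd piles.\<close>

lemma card_bool_lists_count:
  "card {bs. length bs = k \<and> count_list bs True = c} = k choose c"
proof (induction k arbitrary: c)
  case 0
  have "{bs :: bool list. length bs = 0 \<and> count_list bs True = c} = (if c = 0 then {[]} else {})"
    by auto
  then show ?case
    by (cases c) auto
next
  case (Suc k)
  define L where "L n d = {bs. length bs = n \<and> count_list bs True = d}" for n d
  have fin: "finite (L n d)" for n d
    by (rule finite_subset[OF _ finite_lists_length_eq[of UNIV n]]) (auto simp: L_def)
  have IH: "card (L k d) = k choose d" for d
    using Suc by (simp add: L_def)
  \<comment> \<open>The case \<open>d = 0\<close> is separate because \<open>d - 1\<close> truncates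
    to 0 there and would admit lists starting with \<open>True\<close>.\<close>
  have split: "L (Suc k) d = (#) False ` L k d \<union> (if d = 0 then {} else (#) True ` L k (d - 1))"
    for d
    by (auto simp: L_def length_Suc_conv image_iff split: if_splits)
  have "card (L (Suc k) c) = Suc k choose c"
  proof (cases c)
    case 0
    then show ?thesis
      by (simp add: split card_image IH)
  next
    case (Suc d)
    have "card ((#) False ` L k (Suc d) \<union> (#) True ` L k d) = card (L k (Suc d)) + card (L k d)"
      by (subst card_Un_disjoint) (auto simp: fin card_image)
    then show ?thesis
      by (simp add: split Suc IH)
  qed
  then show ?case
    by (simp add: L_def)
qed

lemma xor_double_add_of_bool:
  "(2 * q + of_bool b) XOR (2 * r + of_bool c) = 2 * (q XOR r) + of_bool (b \<noteq> c)"
  for q r :: nat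
  by (subst xor_nat_rec) auto

text \<open>On lowest bits XOR is addition modulo 2. Applied to the halves of a P-position, this
  makes their total even.\<close>

lemma even_nim_sum_iff: "even (nim_sum ps) \<longleftrightarrow> even (sum_list ps)"
  by (induction ps) (auto simp: nim_sum_def even_xor_iff)

definition attach_bits :: "bool list \<Rightarrow> nat list \<Rightarrow> nat list" where
  "attach_bits bs qs = map2 (\<lambda>b q. 2 * q + of_bool b) bs qs"

lemma length_attach_bits [simp]: "length (attach_bits bs qs) = min (length bs) (length qs)"
  by (simp add: attach_bits_def)

lemma attach_bits_odd_half: "attach_bits (map odd ps) (map (\<lambda>p. p div 2) ps) = ps"
  by (induction ps) (auto simp: attach_bits_def)

lemma odd_half_attach_bits:
  assumes "length bs = length qs"
  shows "map odd (attach_bits bs qs) = bs" "map (\<lambda>p. p div 2) (attach_bits bs qs) = qs"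
  using assms by (induction bs qs rule: list_induct2) (auto simp: attach_bits_def)

lemma sum_list_attach_bits:
  assumes "length bs = length qs"
  shows "sum_list (attach_bits bs qs) = 2 * sum_list qs + count_list bs True"
  using assms by (induction bs qs rule: list_induct2) (auto simp: attach_bits_def)

lemma nim_sum_attach_bits:
  assumes "length bs = length qs"
  shows "nim_sum (attach_bits bs qs) = 2 * nim_sum qs + of_bool (odd (count_list bs True))"
  using assms
proof (induction bs qs rule: list_induct2)
  case Nil
  then show ?case
    by (simp add: attach_bits_def nim_sum_def)
next
  case (Cons b bs q qs)
  have "nim_sum (attach_bits (b # bs) (q # qs)) =
      (2 * q + of_bool b) XOR nim_sum (attach_bits bs qs)"
    by (simp add: attach_bits_def nim_sum_def)
  also have "\<dots> = 2 * nim_sum (q # qs) + of_bool (b \<noteq> odd (count_list bs True))"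
    unfolding Cons.IH xor_double_add_of_bool by (simp add: nim_sum_def)
  finally show ?case
    by (cases b) auto
qed

text \<open>Both recurrences at once: \<open>e\<close> is the parity of
  \<open>N = 2 * M + e\<close>, and \<open>4 * i + 2 * e\<close> is the number of odd piles. As
  \<open>M\<close> is an integer, indices \<open>i > M\<close> contribute 0 through the negative
  argument of \<open>D\<close>.\<close>

lemma D_halve:
  fixes k e :: nat and M :: int
  assumes "e < 2"
  shows "D k (2 * M + int e) = (\<Sum>i\<le>k. (k choose (4 * i + 2 * e)) * D k (M - int i))"
proof -
  define A where "A j = {ps \<in> P_positions k. int (sum_list ps) = 2 * j}" for j
  define B where "B c = {bs. length bs = k \<and> count_list bs True = c}" for c
  define S where "S = (SIGMA i:{..k}. B (4 * i + 2 * e) \<times> A (M - int i))"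
  have finA: "finite (A j)" for j
    unfolding A_def by (rule finite_P_positions_total)
  have finB: "finite (B c)" for c
    by (rule finite_subset[OF _ finite_lists_length_eq[of UNIV k]]) (auto simp: B_def)
  have "bij_betw (\<lambda>(i, bs, qs). attach_bits bs qs) S (A (2 * M + int e))"
  \<comment> \<open>The inverse reads off lowest bits and halves; the index comes from solving
    \<open>c = 4 * i + 2 * e\<close> for \<open>i\<close>, where \<open>c\<close> counts the odd
    piles.\<close>
  proof (rule bij_betw_byWitness[where f' =
        "\<lambda>ps. ((count_list (map odd ps) True - 2 * e) div 4, map odd ps, map (\<lambda>p. p div 2) ps)"])
    show "\<forall>x\<in>S. (\<lambda>ps. ((count_list (map odd ps) True - 2 * e) div 4, map odd ps,
        map (\<lambda>p. p div 2) ps)) ((\<lambda>(i, bs, qs). attach_bits bs qs) x) = x"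
      by (auto simp: S_def A_def B_def P_positions_def odd_half_attach_bits simp del: map_map)
    show "\<forall>ps\<in>A (2 * M + int e). (\<lambda>(i, bs, qs). attach_bits bs qs)
        ((count_list (map odd ps) True - 2 * e) div 4, map odd ps, map (\<lambda>p. p div 2) ps) = ps"
      by (simp add: attach_bits_odd_half)
    \<comment> \<open>The count \<open>4 * i + 2 * e\<close> is even, so the nim-sum stays 0; the
      total is \<open>4 * (M - i) + 4 * i + 2 * e = 2 * (2 * M + e)\<close>.\<close>
    show "(\<lambda>(i, bs, qs). attach_bits bs qs) ` S \<subseteq> A (2 * M + int e)"
      by (auto simp: S_def A_def B_def P_positions_def nim_sum_attach_bits sum_list_attach_bits)
    show "(\<lambda>ps. ((count_list (map odd ps) True - 2 * e) div 4, map odd ps,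
        map (\<lambda>p. p div 2) ps)) ` A (2 * M + int e) \<subseteq> S"
    proof (rule image_subsetI)
      fix ps assume ps: "ps \<in> A (2 * M + int e)"
      define bs where "bs = map odd ps"
      define qs where "qs = map (\<lambda>p. p div 2) ps"
      define c where "c = count_list bs True"
      have len: "length bs = k" "length qs = k"
        using ps by (auto simp: A_def P_positions_def bs_def qs_def)
      have join: "attach_bits bs qs = ps"
        unfolding bs_def qs_def by (rule attach_bits_odd_half)
      have nim: "nim_sum qs = 0"
        using nim_sum_attach_bits[of bs qs] len join ps by (auto simp: A_def P_positions_def)
      then obtain m where m: "sum_list qs = 2 * m"
        using even_nim_sum_iff[of qs] by auto
      have tot: "2 * (2 * M + int e) = 4 * int m + int c"
        using sum_list_attach_bits[of bs qs] len join ps m by (auto simp: A_def c_def)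
      \<comment> \<open>No truncation occurs: \<open>4 * (M - m) + 2 * e = c\<close> is nonnegative
        and \<open>e < 2\<close>, so \<open>M - m > -1\<close>.\<close>
      define i where "i = nat (M - int m)"
      have i: "int i = M - int m" "c = 4 * i + 2 * e"
        using tot assms by (auto simp: i_def)
      \<comment> \<open>Since \<open>i \<le> c\<close>, this bound puts \<open>i\<close> in the
        index range of \<open>S\<close>.\<close>
      have "c \<le> k"
        using count_le_length[of bs True] len by (simp add: c_def)
      then have "(i, bs, qs) \<in> S"
        using i len nim m by (auto simp: S_def A_def B_def P_positions_def c_def)
      then show "((count_list (map odd ps) True - 2 * e) div 4, map odd ps,
          map (\<lambda>p. p div 2) ps) \<in> S"
        unfolding bs_def[symmetric] qs_def[symmetric] c_def[symmetric] i(2) by simp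
    qed
  qed
  then have "D k (2 * M + int e) = card S"
    by (simp add: bij_betw_same_card D_def A_def)
  also have "\<dots> = (\<Sum>i\<le>k. card (B (4 * i + 2 * e)) * card (A (M - int i)))"
    by (simp add: S_def card_SigmaI finA finB card_cartesian_product)
  finally show ?thesis
    by (simp add: card_bool_lists_count B_def A_def D_def)
qed

theorem theorem29:
  fixes k n :: nat
  assumes "k \<ge> 1"
  shows "D k (2 * int n + 1) = (\<Sum>i. (k choose (4 * i + 2)) * D k (int n - int i)) \<and>
         D k (2 * int n + 2) = (\<Sum>i. (k choose (4 * i)) * D k (int n + 1 - int i))"
proof
  \<comment> \<open>The infinite series is a finite sum: for \<open>i > k\<close> the lower index of
    the binomial exceeds \<open>k\<close>.\<close>
  have "(\<Sum>i. (k choose (4 * i + 2)) * D k (int n - int i)) =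
      (\<Sum>i\<le>k. (k choose (4 * i + 2)) * D k (int n - int i))"
    by (rule suminf_finite) (auto simp: binomial_eq_0)
  then show "D k (2 * int n + 1) = (\<Sum>i. (k choose (4 * i + 2)) * D k (int n - int i))"
    using D_halve[of 1 k "int n"] by simp
  have "(\<Sum>i. (k choose (4 * i)) * D k (int n + 1 - int i)) =
      (\<Sum>i\<le>k. (k choose (4 * i)) * D k (int n + 1 - int i))"
    by (rule suminf_finite) (auto simp: binomial_eq_0)
  then show "D k (2 * int n + 2) = (\<Sum>i. (k choose (4 * i)) * D k (int n + 1 - int i))"
    \<comment> \<open>The even case takes \<open>M = n + 1\<close>, as
      \<open>2 * n + 2 = 2 * M\<close>.\<close>
    using D_halve[of 0 k "int n + 1"] by (simp add: algebra_simps)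
qed

end
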